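(* Let $(\Xi,d)$ be a Polish space, $p\in[1,\infty)$, $\theta>0$, $\nu\in\mathcal P(\Xi)$, and let $\Psi:\Xi\to\mathbb R$ be Borel measurable with $\int_\Xi|\Psi|\,d\nu<\infty$. Suppose that the growth rate satisfies $\kappa<\infty$. Then $v_P=v_D<\infty$, where $$v_P=\sup_{\mu\in\mathcal P(\Xi)}\Big\{\int_\Xi\Psi(\xi)\,\mu(d\xi)\;:\;W_p(\mu,\nu)\le\theta\Big\},\qquad v_D=\inf_{\lambda\ge0}\Big\{\lambda\theta^p-\int_\Xi\inf_{\xi\in\Xi}\big[\lambda d^p(\xi,\zeta)-\Psi(\xi)\big]\,\nu(d\zeta)\Big\}.$$
   Context: $\mathcal P(\Xi)$ is the set of Borel probability measures on $\Xi$, and $d^p(\xi,\zeta):=d(\xi,\zeta)^p$. For $\mu,\nu\in\mathcal P(\Xi)$, $W_p(\mu,\nu)\in[0,\infty]$ is defined by $W_p^p(\mu,\nu)=\min_\gamma\int_{\Xi\times\Xi}d^p(\xi,\zeta)\,\gamma(d\xi,d\zeta)$, over $\gamma\in\mathcal P(\Xi\times\Xi)$ with first marginal $\mu$ and second marginal $\nu$. Let $\Phi(\lambda,\zeta):=\inf_{\xi\in\Xi}\{\lambda d^p(\xi,\zeta)-\Psi(\xi)\}\in[-\infty,\infty)$ for $\lambda\ge 0$. $\Phi(\lambda,\cdot)$ is measurable with respect to the $\nu$-completion of the Borel $\sigma$-algebra, and $\Phi(\lambda,\zeta)\le-\Psi(\zeta)$, so $\int\Phi(\lambda,\zeta)\,\nu(d\zeta)\in[-\infty,\infty)$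 is well defined. The growth rate of $\Psi$ is $\kappa:=\inf\{\lambda\ge0:\int_\Xi\Phi(\lambda,\zeta)\,\nu(d\zeta)>-\infty\}$, with $\kappa=\infty$ if no such $\lambda$ exists. The supremum in $v_P$ is over $\mu$ for which $\int\Psi\,d\mu$ is well defined in $[-\infty,\infty]$. *)

theory Defs
  imports "HOL-Probability.Probability"
begin

text \<open>
  Borel probability measures on a space are the elements of \<open>space (prob_algebra borel)\<close>.
\<close>

text \<open>
  Integral of an extended-real function as positive part minus negative part (\<open>e2ennreal\<close>
  truncates negative values to \<open>0\<close>).  It is meaningful only if one of the two parts has a finite
  integral; as \<open>\<infinity> - \<infinity> = \<infinity>\<close> in \<^typ>\<open>ereal\<close>, this has to be required separately where it is not
  automatic.
\<close>

definition ext_integral_defined :: "'a measure \<Rightarrow> ('a \<Rightarrow> ereal) \<Rightarrow> bool" where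
  "ext_integral_defined M f \<longleftrightarrow>
     f \<in> borel_measurable M \<and>
     ((\<integral>\<^sup>+ x. e2ennreal (f x) \<partial>M) < \<infinity> \<or> (\<integral>\<^sup>+ x. e2ennreal (- f x) \<partial>M) < \<infinity>)"

definition ext_integral :: "'a measure \<Rightarrow> ('a \<Rightarrow> ereal) \<Rightarrow> ereal" where
  "ext_integral M f =
     enn2ereal (\<integral>\<^sup>+ x. e2ennreal (f x) \<partial>M) - enn2ereal (\<integral>\<^sup>+ x. e2ennreal (- f x) \<partial>M)"

definition couplings ::
    "'a::second_countable_topology measure \<Rightarrow> 'a measure \<Rightarrow> ('a \<times> 'a) measure set" where
  "couplings \<mu> \<nu> =
     {\<gamma> \<in> space (prob_algebra borel). distr \<gamma> borel fst = \<mu> \<and> distr \<gamma> borel snd = \<nu>}"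

definition transport_cost :: "real \<Rightarrow> 'a::polish_space measure \<Rightarrow> 'a measure \<Rightarrow> ennreal" where
  "transport_cost p \<mu> \<nu> =
     (INF \<gamma> \<in> couplings \<mu> \<nu>. \<integral>\<^sup>+ z. ennreal (dist (fst z) (snd z) powr p) \<partial>\<gamma>)"

definition wasserstein :: "real \<Rightarrow> 'a::polish_space measure \<Rightarrow> 'a measure \<Rightarrow> ennreal" where
  "wasserstein p \<mu> \<nu> =
     (if transport_cost p \<mu> \<nu> = \<infinity> then \<infinity>
      else ennreal (enn2real (transport_cost p \<mu> \<nu>) powr (1 / p)))"

definition Phi :: "real \<Rightarrow> ('a::polish_space \<Rightarrow> real) \<Rightarrow> real \<Rightarrow> 'a \<Rightarrow> ereal" where
  "Phi p \<Psi> l \<zeta> = (INF \<xi>. ereal (l * dist \<xi> \<zeta> powr p - \<Psi> \<xi>))"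

text \<open>
  \<open>Phi p \<Psi> l\<close> need not be Borel measurable but is measurable for the completion of \<open>\<nu>\<close>; it is
  bounded above by \<open>- \<Psi>\<close>, so its integral is well defined in \<open>[-\<infinity>, \<infinity>)\<close> once \<open>\<Psi>\<close> is integrable.
\<close>

definition Phi_integral ::
    "real \<Rightarrow> 'a::polish_space measure \<Rightarrow> ('a \<Rightarrow> real) \<Rightarrow> real \<Rightarrow> ereal" where
  "Phi_integral p \<nu> \<Psi> l = ext_integral (completion \<nu>) (Phi p \<Psi> l)"

text \<open>The infimum of the empty set is \<open>\<infinity>\<close> in \<^typ>\<open>ereal\<close>.\<close>

definition growth_rate :: "real \<Rightarrow> 'a::polish_space measure \<Rightarrow> ('a \<Rightarrow> real) \<Rightarrow> ereal" where
  "growth_rate p \<nu> \<Psi> = Inf (ereal ` {l. 0 \<le> l \<and> Phi_integral p \<nu> \<Psi> l > - \<infinity>})"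

definition primal_value ::
    "real \<Rightarrow> real \<Rightarrow> 'a::polish_space measure \<Rightarrow> ('a \<Rightarrow> real) \<Rightarrow> ereal" where
  "primal_value p \<theta> \<nu> \<Psi> =
     (SUP \<mu> \<in> {\<mu> \<in> space (prob_algebra borel).
                 wasserstein p \<mu> \<nu> \<le> ennreal \<theta> \<and> ext_integral_defined \<mu> (\<lambda>\<xi>. ereal (\<Psi> \<xi>))}.
        ext_integral \<mu> (\<lambda>\<xi>. ereal (\<Psi> \<xi>)))"

definition dual_value ::
    "real \<Rightarrow> real \<Rightarrow> 'a::polish_space measure \<Rightarrow> ('a \<Rightarrow> real) \<Rightarrow> ereal" where
  "dual_value p \<theta> \<nu> \<Psi> = (INF l \<in> {0..}. ereal (l * \<theta> powr p) - Phi_integral p \<nu> \<Psi> l)"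

end

theory Submission
  imports Defs
begin

text \<open>
  Write \<open>c(\<xi>, \<zeta>) = dist \<xi> \<zeta> powr p\<close> and \<open>t = \<theta> powr p\<close>.

  As an infimum of continuous functions of \<open>\<zeta>\<close>, \<open>Phi p \<Psi> l\<close> is upper semicontinuous, whatever
  \<open>\<Psi>\<close> is; so it is Borel, and completing \<open>\<nu>\<close> does not change its integral.  Everything is then
  expressed through the nonnegative function \<open>gap = - \<Psi> - Phi\<close>, the largest net gain
  \<open>\<Psi> \<xi> - l c(\<xi>, \<zeta>) - \<Psi> \<zeta>\<close> obtainable by moving the mass at \<open>\<zeta>\<close> to some \<open>\<xi>\<close> at the price \<open>l\<close> per
  unit of cost.  The dual objective at \<open>l\<close> is \<open>l t + \<integral>\<Psi> d\<nu> + \<integral>gap d\<nu>\<close>.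

  Weak duality integrates \<open>\<Psi> \<xi> \<le> l c(\<xi>, \<zeta>) + \<Psi> \<zeta> + gap \<zeta>\<close> against a coupling of nearly optimal
  cost (\<open>coupling_integral_le\<close>, \<open>weak_duality\<close>).

  For the converse let \<open>v\<close> be the primal value, assumed finite, and consider the set of pairs
  \<open>(\<integral>c(T \<zeta>, \<zeta>) d\<nu>, \<integral>\<Psi> (T \<zeta>) d\<nu>)\<close> for Borel maps \<open>T\<close> making both integrals finite.  Choosing between
  two such maps by an independent coin flip is again a transport plan, so every convex combination
  of two pairs with first coordinate at most \<open>t\<close> has second coordinate at most \<open>v\<close>
  (\<open>mixture_value_le_primal_value\<close>).  The identity map gives a pair over \<open>0 < t\<close>, a Slater point,
  so there is a line of slope \<open>l \<ge> 0\<close> through \<open>(t, v)\<close> above all the pairs (\<open>supporting_slope\<close>).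
  This slope is the dual multiplier: for no map does \<open>\<integral>\<Psi> (T \<zeta>) d\<nu>\<close> net of the price of
  moving exceed \<open>v - l t\<close>, and since
  maps with finitely many values besides the identity attain the supremum defining \<open>gap\<close> in the
  limit, \<open>\<integral>gap d\<nu> \<le> v - l t - \<integral>\<Psi> d\<nu>\<close> (\<open>integral_gap_le\<close>).  That is, the dual objective at \<open>l\<close> is
  at most \<open>v\<close>.  A finite growth rate provides some \<open>l\<close> with finite dual objective.
\<close>

section \<open>Integrals of extended real functions\<close>

lemma ext_integral_integrable:
  fixes u :: "'a \<Rightarrow> real"
  assumes "integrable M u"
  shows "ext_integral M (\<lambda>x. ereal (u x)) = ereal (\<integral>x. u x \<partial>M)"
proof -
  have "(\<integral>\<^sup>+ x. ennreal (u x) \<partial>M) \<noteq> \<infinity>" "(\<integral>\<^sup>+ x. ennreal (- u x) \<partial>M) \<noteq> \<infinity>"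
    using assms unfolding real_integrable_def by auto
  then show ?thesis
    unfolding ext_integral_def real_lebesgue_integral_def[OF assms]
    by (cases "\<integral>\<^sup>+ x. ennreal (u x) \<partial>M"; cases "\<integral>\<^sup>+ x. ennreal (- u x) \<partial>M") auto
qed

text \<open>
  With \<open>u = f + g\<close> and \<open>g \<ge> 0\<close>, the positive and negative parts satisfy
  \<open>f\<^sup>+ + g + u\<^sup>- = f\<^sup>- + u\<^sup>+\<close>.  This is an identity of nonnegative functions, so it can be integrated
  termwise; only \<open>\<integral>g\<close> and \<open>\<integral>f\<^sup>-\<close> may be infinite, and then they are so together.
\<close>

lemma ext_integral_dominated:
  fixes u :: "'a \<Rightarrow> real"
  assumes u: "integrable M u" and f[measurable]: "f \<in> borel_measurable M"
    and le: "\<And>x. f x \<le> ereal (u x)"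
  shows "ext_integral M f = ereal (\<integral>x. u x \<partial>M) - enn2ereal (\<integral>\<^sup>+ x. e2ennreal (ereal (u x) - f x) \<partial>M)"
proof -
  have [measurable]: "u \<in> borel_measurable M" using u by auto
  define A B G where "A = (\<integral>\<^sup>+ x. ennreal (u x) \<partial>M)" and "B = (\<integral>\<^sup>+ x. ennreal (- u x) \<partial>M)"
    and "G = (\<integral>\<^sup>+ x. e2ennreal (ereal (u x) - f x) \<partial>M)"
  define P N where "P = (\<integral>\<^sup>+ x. e2ennreal (f x) \<partial>M)" and "N = (\<integral>\<^sup>+ x. e2ennreal (- f x) \<partial>M)"
  have fin: "A \<noteq> \<infinity>" "B \<noteq> \<infinity>" using u unfolding real_integrable_def A_def B_def by auto
  have "P \<le> A" unfolding P_def A_def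
    using e2ennreal_mono[OF le] by (intro nn_integral_mono) simp
  have pt: "e2ennreal (f x) + e2ennreal (ereal (u x) - f x) + ennreal (- u x)
      = e2ennreal (- f x) + ennreal (u x)" for x
  proof (cases "f x")
    case (real r)
    then show ?thesis using le[of x]
      by (cases "0 \<le> r"; cases "0 \<le> u x") (auto simp: ennreal_neg simp flip: ennreal_plus)
  qed (use le[of x] in \<open>auto simp: e2ennreal_neg\<close>)
  have "P + G + B = (\<integral>\<^sup>+ x. e2ennreal (f x) + e2ennreal (ereal (u x) - f x) + ennreal (- u x) \<partial>M)"
    unfolding P_def G_def B_def by (simp add: nn_integral_add)
  also have "\<dots> = N + A"
    unfolding pt unfolding N_def A_def by (simp add: nn_integral_add)
  finally have eq: "P + G + B = N + A" .
  have "ereal (\<integral>x. u x \<partial>M) = ereal (enn2real A - enn2real B)"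
    unfolding real_lebesgue_integral_def[OF u] A_def B_def ..
  then show ?thesis
    using eq fin \<open>P \<le> A\<close> unfolding ext_integral_def P_def[symmetric] N_def[symmetric] G_def[symmetric]
    by (cases P; cases N; cases A; cases B; cases G)
      (auto simp: ennreal_plus[symmetric] top_unique simp del: ennreal_plus)
qed

section \<open>The function \<open>Phi\<close> and the gap\<close>

text \<open>
  Measuring the gain relative to leaving the mass in place makes it nonnegative, so that its
  integral always exists and monotone convergence applies.
\<close>

definition gap :: "real \<Rightarrow> ('a::polish_space \<Rightarrow> real) \<Rightarrow> real \<Rightarrow> 'a \<Rightarrow> ennreal" where
  "gap p \<Psi> l \<zeta> = e2ennreal (ereal (- \<Psi> \<zeta>) - Phi p \<Psi> l \<zeta>)"

lemma continuous_on_dist_powr: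
  fixes \<xi> :: "'a::metric_space"
  assumes "0 < p"
  shows "continuous_on UNIV (\<lambda>\<zeta>. dist \<xi> \<zeta> powr p)"
  using assms by (intro continuous_on_powr' continuous_intros) auto

text \<open>
  The sublevel sets \<open>{Phi < y}\<close> are open, being unions over \<open>\<xi>\<close> of sets that are
  open because \<open>\<zeta>\<close> enters only through the continuous cost.
\<close>

lemma borel_measurable_Phi:
  assumes "0 < p"
  shows "Phi p \<Psi> l \<in> borel_measurable borel"
proof (rule borel_measurableI_less)
  fix y
  have "open {\<zeta>. ereal (l * dist \<xi> \<zeta> powr p - \<Psi> \<xi>) < y}" for \<xi>
    by (intro open_Collect_less continuous_on_ereal continuous_intros
        continuous_on_dist_powr[OF assms])
  then have "open (\<Union>\<xi>. {\<zeta>. ereal (l * dist \<xi> \<zeta> powr p - \<Psi> \<xi>) < y})" by auto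
  also have "(\<Union>\<xi>. {\<zeta>. ereal (l * dist \<xi> \<zeta> powr p - \<Psi> \<xi>) < y}) = {\<zeta>. Phi p \<Psi> l \<zeta> < y}"
    by (auto simp: Phi_def INF_less_iff)
  finally show "{x \<in> space borel. Phi p \<Psi> l x < y} \<in> sets borel" by simp
qed

lemma Phi_le: "Phi p \<Psi> l \<zeta> \<le> ereal (- \<Psi> \<zeta>)"
  unfolding Phi_def by (rule INF_lower2[of \<zeta>]) auto

lemma gain_le_gap: "ennreal (\<Psi> \<xi> - l * dist \<xi> \<zeta> powr p - \<Psi> \<zeta>) \<le> gap p \<Psi> l \<zeta>"
proof -
  have "Phi p \<Psi> l \<zeta> \<le> ereal (l * dist \<xi> \<zeta> powr p - \<Psi> \<xi>)"
    unfolding Phi_def by (rule INF_lower) auto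
  then have "ereal (\<Psi> \<xi> - l * dist \<xi> \<zeta> powr p - \<Psi> \<zeta>) \<le> ereal (- \<Psi> \<zeta>) - Phi p \<Psi> l \<zeta>"
    by (cases "Phi p \<Psi> l \<zeta>") auto
  from e2ennreal_mono[OF this] show ?thesis by (simp add: gap_def)
qed

lemma gap_leI:
  assumes "\<And>\<xi>. \<Psi> \<xi> - l * dist \<xi> \<zeta> powr p \<le> \<Psi> \<zeta> + s"
  shows "gap p \<Psi> l \<zeta> \<le> ennreal s"
proof -
  have "ereal (- \<Psi> \<zeta> - s) \<le> Phi p \<Psi> l \<zeta>"
    unfolding Phi_def using assms by (intro INF_greatest) (auto simp: algebra_simps)
  then have "ereal (- \<Psi> \<zeta>) - Phi p \<Psi> l \<zeta> \<le> ereal s"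
    by (cases "Phi p \<Psi> l \<zeta>") auto
  from e2ennreal_mono[OF this] show ?thesis by (simp add: gap_def)
qed

lemma Phi_integral_eq:
  assumes "0 < p" and \<nu>: "sets \<nu> = sets borel" and "integrable \<nu> \<Psi>"
  shows "Phi_integral p \<nu> \<Psi> l = ereal (- (\<integral>\<zeta>. \<Psi> \<zeta> \<partial>\<nu>)) - enn2ereal (\<integral>\<^sup>+ \<zeta>. gap p \<Psi> l \<zeta> \<partial>\<nu>)"
proof -
  have "Phi_integral p \<nu> \<Psi> l = ext_integral \<nu> (Phi p \<Psi> l)"
    by (simp add: Phi_integral_def ext_integral_def nn_integral_completion)
  also have "\<dots> = ereal (\<integral>\<zeta>. - \<Psi> \<zeta> \<partial>\<nu>) - enn2ereal (\<integral>\<^sup>+ \<zeta>. gap p \<Psi> l \<zeta> \<partial>\<nu>)"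
    unfolding gap_def
    using assms borel_measurable_Phi[OF assms(1), of \<Psi> l] measurable_cong_sets[OF \<nu> refl]
    by (intro ext_integral_dominated Phi_le) auto
  finally show ?thesis by simp
qed

section \<open>Weak duality\<close>

lemma wasserstein_le_iff:
  assumes "1 \<le> p" "0 < \<theta>"
  shows "wasserstein p \<mu> \<nu> \<le> ennreal \<theta> \<longleftrightarrow> transport_cost p \<mu> \<nu> \<le> ennreal (\<theta> powr p)"
proof (cases "transport_cost p \<mu> \<nu>")
  case (real c)
  have "c powr (1 / p) \<le> \<theta> \<longleftrightarrow> c \<le> \<theta> powr p"
  proof
    assume "c powr (1 / p) \<le> \<theta>"
    then have "(c powr (1 / p)) powr p \<le> \<theta> powr p" using assms by (intro powr_mono2) auto
    then show "c \<le> \<theta> powr p" using assms real by (simp add: powr_powr)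
  next
    assume "c \<le> \<theta> powr p"
    then have "c powr (1 / p) \<le> (\<theta> powr p) powr (1 / p)"
      using assms real by (intro powr_mono2) auto
    then show "c powr (1 / p) \<le> \<theta>" using assms by (simp add: powr_powr)
  qed
  then show ?thesis using real assms by (simp add: wasserstein_def)
qed (use assms in \<open>auto simp: wasserstein_def top_unique\<close>)

text \<open>
  The inequality \<open>\<Psi> \<xi> \<le> l c(\<xi>, \<zeta>) + \<Psi> \<zeta> + gap \<zeta>\<close>, integrated against \<open>\<gamma>\<close>.  The negative parts of
  \<open>\<Psi>\<close> are moved to the opposite sides, so that both sides make sense even where an integral of
  \<open>\<Psi>\<close> under \<open>\<mu>\<close> diverges.
\<close>

lemma coupling_integral_le:
  assumes "1 \<le> p" "0 \<le> l" and [measurable]: "\<Psi> \<in> borel_measurable borel"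
    and \<gamma>: "\<gamma> \<in> couplings \<mu> \<nu>"
  shows "(\<integral>\<^sup>+ \<xi>. ennreal (\<Psi> \<xi>) \<partial>\<mu>) + (\<integral>\<^sup>+ \<zeta>. ennreal (- \<Psi> \<zeta>) \<partial>\<nu>)
      \<le> ennreal l * (\<integral>\<^sup>+ z. ennreal (dist (fst z) (snd z) powr p) \<partial>\<gamma>) + (\<integral>\<^sup>+ \<zeta>. gap p \<Psi> l \<zeta> \<partial>\<nu>)
        + (\<integral>\<^sup>+ \<zeta>. ennreal (\<Psi> \<zeta>) \<partial>\<nu>) + (\<integral>\<^sup>+ \<xi>. ennreal (- \<Psi> \<xi>) \<partial>\<mu>)"
proof -
  have sets_\<gamma>[measurable_cong]: "sets \<gamma> = sets (borel \<Otimes>\<^sub>M borel)"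
    and \<mu>: "\<mu> = distr \<gamma> borel fst" and \<nu>': "\<nu> = distr \<gamma> borel snd"
    using \<gamma> unfolding couplings_def space_prob_algebra borel_prod by blast+
  have [measurable]: "Phi p \<Psi> l \<in> borel_measurable borel"
    using borel_measurable_Phi[of p \<Psi> l] \<open>1 \<le> p\<close> by simp
  have [measurable]: "gap p \<Psi> l \<in> borel_measurable borel"
    unfolding gap_def[abs_def] by simp
  have pt: "ennreal (\<Psi> \<xi>) + ennreal (- \<Psi> \<zeta>)
      \<le> ennreal l * ennreal (dist \<xi> \<zeta> powr p) + gap p \<Psi> l \<zeta> + ennreal (\<Psi> \<zeta>) + ennreal (- \<Psi> \<xi>)" for \<xi> \<zeta>
  proof -
    let ?d = "l * dist \<xi> \<zeta> powr p"
    have "ennreal (\<Psi> \<xi>) + ennreal (- \<Psi> \<zeta>) = ennreal (max 0 (\<Psi> \<xi>) + max 0 (- \<Psi> \<zeta>))"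
      by (simp add: ennreal_plus)
    also have "\<dots> \<le> ennreal (?d + max 0 (\<Psi> \<xi> - ?d - \<Psi> \<zeta>) + max 0 (\<Psi> \<zeta>) + max 0 (- \<Psi> \<xi>))"
      using \<open>0 \<le> l\<close> by (intro ennreal_leI) (auto simp: max_def)
    also have "\<dots> = ennreal l * ennreal (dist \<xi> \<zeta> powr p) + ennreal (\<Psi> \<xi> - ?d - \<Psi> \<zeta>)
        + ennreal (\<Psi> \<zeta>) + ennreal (- \<Psi> \<xi>)"
      using \<open>0 \<le> l\<close> by (simp add: ennreal_plus ennreal_mult)
    also have "\<dots> \<le> ennreal l * ennreal (dist \<xi> \<zeta> powr p) + gap p \<Psi> l \<zeta> + ennreal (\<Psi> \<zeta>) + ennreal (- \<Psi> \<xi>)"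
      by (intro add_mono order_refl gain_le_gap)
    finally show ?thesis .
  qed
  have "(\<integral>\<^sup>+ z. ennreal (\<Psi> (fst z)) + ennreal (- \<Psi> (snd z)) \<partial>\<gamma>)
      \<le> (\<integral>\<^sup>+ z. ennreal l * ennreal (dist (fst z) (snd z) powr p) + gap p \<Psi> l (snd z)
          + ennreal (\<Psi> (snd z)) + ennreal (- \<Psi> (fst z)) \<partial>\<gamma>)"
    by (intro nn_integral_mono pt)
  then show ?thesis
    unfolding \<mu> \<nu>' by (simp add: nn_integral_distr nn_integral_add nn_integral_cmult)
qed

lemma weak_duality:
  assumes p: "1 \<le> p" and "0 < \<theta>" and l: "0 \<le> l" and \<nu>: "sets \<nu> = sets borel"
    and \<Psi>: "\<Psi> \<in> borel_measurable borel" "integrable \<nu> \<Psi>"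
  shows "primal_value p \<theta> \<nu> \<Psi> \<le> ereal (l * \<theta> powr p) - Phi_integral p \<nu> \<Psi> l"
  unfolding primal_value_def
proof (intro SUP_least)
  fix \<mu> assume \<mu>: "\<mu> \<in> {\<mu> \<in> space (prob_algebra borel).
      wasserstein p \<mu> \<nu> \<le> ennreal \<theta> \<and> ext_integral_defined \<mu> (\<lambda>\<xi>. ereal (\<Psi> \<xi>))}"
  define A B G where "A = (\<integral>\<^sup>+ \<zeta>. ennreal (\<Psi> \<zeta>) \<partial>\<nu>)" and "B = (\<integral>\<^sup>+ \<zeta>. ennreal (- \<Psi> \<zeta>) \<partial>\<nu>)"
    and "G = (\<integral>\<^sup>+ \<zeta>. gap p \<Psi> l \<zeta> \<partial>\<nu>)"
  define A' B' where "A' = (\<integral>\<^sup>+ \<xi>. ennreal (\<Psi> \<xi>) \<partial>\<mu>)" and "B' = (\<integral>\<^sup>+ \<xi>. ennreal (- \<Psi> \<xi>) \<partial>\<mu>)"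
  have fin: "A \<noteq> \<infinity>" "B \<noteq> \<infinity>" using \<Psi>(2) unfolding real_integrable_def A_def B_def by auto
  have int_\<Psi>: "(\<integral>\<zeta>. \<Psi> \<zeta> \<partial>\<nu>) = enn2real A - enn2real B"
    unfolding real_lebesgue_integral_def[OF \<Psi>(2)] A_def B_def ..
  have "transport_cost p \<mu> \<nu> \<le> ennreal (\<theta> powr p)"
    using \<mu> wasserstein_le_iff[OF p \<open>0 < \<theta>\<close>, of \<mu> \<nu>] by simp
  have main: "A' + B \<le> ennreal (l * \<theta> powr p) + G + A + B'"
  proof (rule ennreal_le_epsilon)
    fix e :: real assume "0 < e"
    \<comment> \<open>Dividing by \<open>l + 1\<close> rather than \<open>l\<close> covers \<open>l = 0\<close>; \<open>\<delta>\<close> is the slack for a coupling that is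
      only nearly optimal.\<close>
    define \<delta> where "\<delta> = e / (l + 1)"
    have \<delta>: "0 < \<delta>" "l * \<delta> \<le> e"
      using \<open>0 < e\<close> l by (auto simp: \<delta>_def field_simps)
    have "transport_cost p \<mu> \<nu> < ennreal (\<theta> powr p + \<delta>)"
      using \<open>transport_cost p \<mu> \<nu> \<le> ennreal (\<theta> powr p)\<close> \<delta>(1)
      by (rule_tac le_less_trans) (auto intro!: ennreal_lessI add_nonneg_pos)
    then obtain \<gamma> where \<gamma>: "\<gamma> \<in> couplings \<mu> \<nu>"
      and cost: "(\<integral>\<^sup>+ z. ennreal (dist (fst z) (snd z) powr p) \<partial>\<gamma>) < ennreal (\<theta> powr p + \<delta>)"
      unfolding transport_cost_def INF_less_iff by auto
    have "ennreal l * (\<integral>\<^sup>+ z. ennreal (dist (fst z) (snd z) powr p) \<partial>\<gamma>)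
        \<le> ennreal l * ennreal (\<theta> powr p + \<delta>)"
      using cost by (intro mult_left_mono) auto
    also have "\<dots> = ennreal (l * \<theta> powr p + l * \<delta>)"
      using l \<delta> by (simp add: ennreal_mult[symmetric] distrib_left)
    also have "\<dots> \<le> ennreal (l * \<theta> powr p + e)"
      using \<delta>(2) by (intro ennreal_leI) simp
    also have "\<dots> = ennreal (l * \<theta> powr p) + ennreal e"
      using l \<open>0 < e\<close> by (simp add: ennreal_plus)
    finally have *: "ennreal l * (\<integral>\<^sup>+ z. ennreal (dist (fst z) (snd z) powr p) \<partial>\<gamma>)
        \<le> ennreal (l * \<theta> powr p) + ennreal e" .
    have "A' + B \<le> ennreal l * (\<integral>\<^sup>+ z. ennreal (dist (fst z) (snd z) powr p) \<partial>\<gamma>) + G + A + B'"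
      unfolding A_def B_def A'_def B'_def G_def by (rule coupling_integral_le[OF p l \<Psi>(1) \<gamma>])
    also have "\<dots> \<le> (ennreal (l * \<theta> powr p) + ennreal e) + G + A + B'"
      by (intro add_mono order_refl *)
    finally show "A' + B \<le> ennreal (l * \<theta> powr p) + G + A + B' + ennreal e"
      by (simp add: ac_simps)
  qed
  have "A' < \<infinity> \<or> B' < \<infinity>"
    using \<mu> by (simp add: ext_integral_defined_def A'_def B'_def)
  moreover have "ext_integral \<mu> (\<lambda>\<xi>. ereal (\<Psi> \<xi>)) = enn2ereal A' - enn2ereal B'"
    by (simp add: ext_integral_def A'_def B'_def)
  moreover have "0 \<le> l * \<theta> powr p" using l by simp
  moreover have "Phi_integral p \<nu> \<Psi> l = ereal (enn2real B - enn2real A) - enn2ereal G"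
    using Phi_integral_eq[OF _ \<nu> \<Psi>(2), of p l] p by (simp add: int_\<Psi> G_def)
  ultimately show "ext_integral \<mu> (\<lambda>\<xi>. ereal (\<Psi> \<xi>)) \<le> ereal (l * \<theta> powr p) - Phi_integral p \<nu> \<Psi> l"
    using main fin
    by (cases A'; cases B'; cases A; cases B; cases G)
      (auto simp: ennreal_plus[symmetric] top_unique simp del: ennreal_plus)
qed

section \<open>Randomised transport maps\<close>

text \<open>
  Flipping an independent coin of bias \<open>\<alpha>\<close> to decide which of two maps moves \<open>\<zeta>\<close> gives a coupling
  whose cost and gain are the corresponding convex combinations.  The randomisation is what makes
  the attainable pairs of cost and gain convex: for \<open>\<nu>\<close> with atoms, maps alone do not suffice.
\<close>

lemma mixture_value_le_primal_value:
  fixes T :: "bool \<Rightarrow> 'a::polish_space \<Rightarrow> 'a"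
  assumes p: "1 \<le> p" and "0 < \<theta>" and \<nu>: "\<nu> \<in> space (prob_algebra borel)"
    and [measurable]: "\<Psi> \<in> borel_measurable borel" and T[measurable]: "\<And>c. T c \<in> borel \<rightarrow>\<^sub>M borel"
    and cost: "\<And>c. integrable \<nu> (\<lambda>\<zeta>. dist (T c \<zeta>) \<zeta> powr p)"
    and gain: "\<And>c. integrable \<nu> (\<lambda>\<zeta>. \<Psi> (T c \<zeta>))"
    and \<alpha>: "0 \<le> \<alpha>" "\<alpha> \<le> 1"
    and le: "\<alpha> * (\<integral>\<zeta>. dist (T True \<zeta>) \<zeta> powr p \<partial>\<nu>)
      + (1 - \<alpha>) * (\<integral>\<zeta>. dist (T False \<zeta>) \<zeta> powr p \<partial>\<nu>) \<le> \<theta> powr p"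
  shows "ereal (\<alpha> * (\<integral>\<zeta>. \<Psi> (T True \<zeta>) \<partial>\<nu>) + (1 - \<alpha>) * (\<integral>\<zeta>. \<Psi> (T False \<zeta>) \<partial>\<nu>)) \<le> primal_value p \<theta> \<nu> \<Psi>"
proof -
  have sets_\<nu>[measurable_cong]: "sets \<nu> = sets borel" and "prob_space \<nu>"
    using \<nu> by (auto simp: space_prob_algebra)
  interpret \<nu>: prob_space \<nu> by fact
  let ?\<beta> = "measure_pmf (bernoulli_pmf \<alpha>)"
  interpret \<beta>: prob_space ?\<beta> by (rule prob_space_measure_pmf)
  interpret pair_prob_space \<nu> ?\<beta> ..
  let ?N = "\<nu> \<Otimes>\<^sub>M ?\<beta>"
  define h where "h = (\<lambda>(\<zeta>, c). (T c \<zeta>, \<zeta>))"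
  \<comment> \<open>Measurability in the coin is trivial, as it has only two values.\<close>
  have "(\<lambda>z. T (snd z) (fst z)) \<in> ?N \<rightarrow>\<^sub>M borel"
  proof -
    have "(\<lambda>z. T (snd z) (fst z)) = (\<lambda>z. if snd z then T True (fst z) else T False (fst z))"
      by (auto simp: fun_eq_iff)
    then show ?thesis by simp
  qed
  then have h[measurable]: "h \<in> ?N \<rightarrow>\<^sub>M borel"
    unfolding h_def borel_prod[symmetric] split_beta' by measurable
  have *: "integrable ?N (\<lambda>z. f (snd z) (fst z)) \<and>
      (\<integral>z. f (snd z) (fst z) \<partial>?N) = \<alpha> * (\<integral>\<zeta>. f True \<zeta> \<partial>\<nu>) + (1 - \<alpha>) * (\<integral>\<zeta>. f False \<zeta> \<partial>\<nu>)"
    if f: "\<And>c. integrable \<nu> (f c)" for f :: "bool \<Rightarrow> 'a \<Rightarrow> real"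
  proof
    have [measurable]: "f c \<in> borel_measurable \<nu>" for c using f by auto
    have "(\<lambda>z. f (snd z) (fst z)) = (\<lambda>z. if snd z then f True (fst z) else f False (fst z))"
      by (auto simp: fun_eq_iff)
    then have "(\<lambda>z. f (snd z) (fst z)) \<in> borel_measurable ?N" by simp
    then show int: "integrable ?N (\<lambda>z. f (snd z) (fst z))"
      using \<alpha> f by (intro Fubini_integrable) (auto intro!: integrable_measure_pmf_finite)
    from integral_fst'[OF int]
    show "(\<integral>z. f (snd z) (fst z) \<partial>?N) = \<alpha> * (\<integral>\<zeta>. f True \<zeta> \<partial>\<nu>) + (1 - \<alpha>) * (\<integral>\<zeta>. f False \<zeta> \<partial>\<nu>)"
      using \<alpha> f by (simp add: mult.commute)
  qed
  define \<gamma> where "\<gamma> = distr ?N borel h"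
  define \<mu> where "\<mu> = distr \<gamma> borel fst"
  have fst_snd: "fst \<in> (borel :: ('a \<times> 'a) measure) \<rightarrow>\<^sub>M borel" "snd \<in> (borel :: ('a \<times> 'a) measure) \<rightarrow>\<^sub>M borel"
    by (simp_all add: borel_prod[symmetric])
  have \<gamma>_prob: "prob_space \<gamma>" unfolding \<gamma>_def by (intro prob_space_distr h)
  then have \<mu>_prob: "prob_space \<mu>"
    unfolding \<mu>_def by (intro prob_space.prob_space_distr) (simp_all add: \<gamma>_def fst_snd)
  have "distr \<gamma> borel snd = distr ?N borel fst"
    unfolding \<gamma>_def by (subst distr_distr) (auto simp: fst_snd h_def intro!: distr_cong)
  also have "\<dots> = distr ?N \<nu> fst" by (intro distr_cong) (simp_all add: sets_\<nu>)
  also have "\<dots> = \<nu>" by (rule prob_space.distr_pair_fst[OF prob_space_measure_pmf])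
  finally have "\<gamma> \<in> couplings \<mu> \<nu>"
    using \<gamma>_prob by (simp add: couplings_def space_prob_algebra \<mu>_def) (simp add: \<gamma>_def)
  have dist_meas: "(\<lambda>z::'a \<times> 'a. ennreal (dist (fst z) (snd z) powr p)) \<in> borel_measurable borel"
    by (simp add: borel_prod[symmetric])
  have "(\<integral>\<^sup>+ z. ennreal (dist (fst z) (snd z) powr p) \<partial>\<gamma>)
      = (\<integral>\<^sup>+ z. ennreal (dist (T (snd z) (fst z)) (fst z) powr p) \<partial>?N)"
    unfolding \<gamma>_def by (subst nn_integral_distr[OF h]) (simp_all add: dist_meas, simp add: h_def split_beta')
  also have "\<dots> = ennreal (\<integral>z. dist (T (snd z) (fst z)) (fst z) powr p \<partial>?N)"
    using *[of "\<lambda>c \<zeta>. dist (T c \<zeta>) \<zeta> powr p", OF cost] by (intro nn_integral_eq_integral) auto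
  also have "\<dots> \<le> ennreal (\<theta> powr p)"
    using *[of "\<lambda>c \<zeta>. dist (T c \<zeta>) \<zeta> powr p", OF cost] le by (intro ennreal_leI) simp
  finally have "transport_cost p \<mu> \<nu> \<le> ennreal (\<theta> powr p)"
    unfolding transport_cost_def using \<open>\<gamma> \<in> couplings \<mu> \<nu>\<close> by (intro INF_lower2)
  then have "wasserstein p \<mu> \<nu> \<le> ennreal \<theta>"
    using wasserstein_le_iff[OF p \<open>0 < \<theta>\<close>, of \<mu> \<nu>] by simp
  have \<mu>_eq: "\<mu> = distr ?N borel (\<lambda>z. T (snd z) (fst z))"
    unfolding \<mu>_def \<gamma>_def by (subst distr_distr) (auto simp: fst_snd h_def intro!: distr_cong)
  have int_\<mu>: "integrable \<mu> \<Psi>"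
    and val_\<mu>: "(\<integral>\<xi>. \<Psi> \<xi> \<partial>\<mu>) = \<alpha> * (\<integral>\<zeta>. \<Psi> (T True \<zeta>) \<partial>\<nu>) + (1 - \<alpha>) * (\<integral>\<zeta>. \<Psi> (T False \<zeta>) \<partial>\<nu>)"
    using *[of "\<lambda>c \<zeta>. \<Psi> (T c \<zeta>)", OF gain] \<open>(\<lambda>z. T (snd z) (fst z)) \<in> ?N \<rightarrow>\<^sub>M borel\<close>
    unfolding \<mu>_eq by (simp_all add: integrable_distr_eq integral_distr)
  have "ext_integral_defined \<mu> (\<lambda>\<xi>. ereal (\<Psi> \<xi>))"
    using int_\<mu> unfolding ext_integral_defined_def real_integrable_def by (auto simp: less_top)
  then have "ext_integral \<mu> (\<lambda>\<xi>. ereal (\<Psi> \<xi>)) \<le> primal_value p \<theta> \<nu> \<Psi>"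
    unfolding primal_value_def
    using \<mu>_prob \<open>wasserstein p \<mu> \<nu> \<le> ennreal \<theta>\<close>
    by (intro SUP_upper) (simp add: space_prob_algebra \<mu>_def)
  then show ?thesis
    unfolding ext_integral_integrable[OF int_\<mu>] val_\<mu> .
qed

section \<open>A supporting slope\<close>

text \<open>
  A Lagrange multiplier for the problem of maximising \<open>b\<close> subject to \<open>a \<le> t\<close>.  It is the supremum
  of the slopes from \<open>(t, v)\<close> to the points of \<open>C\<close> on its right, or \<open>0\<close> if all these are negative.  If a point
  on the right had a larger slope than one on the left, the segment between the two points would
  pass above \<open>(t, v)\<close>; and the given point with \<open>a0 < t\<close> keeps the supremum finite.
\<close>

lemma supporting_slope:
  fixes C :: "(real \<times> real) set"
  assumes base: "(a0, b0) \<in> C" "a0 < t"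
    and mix: "\<And>a b a' b' \<alpha>. (a, b) \<in> C \<Longrightarrow> (a', b') \<in> C \<Longrightarrow> 0 \<le> \<alpha> \<Longrightarrow> \<alpha> \<le> 1 \<Longrightarrow>
        \<alpha> * a + (1 - \<alpha>) * a' \<le> t \<Longrightarrow> \<alpha> * b + (1 - \<alpha>) * b' \<le> v"
  obtains l where "0 \<le> l" "\<And>a b. (a, b) \<in> C \<Longrightarrow> b - l * a \<le> v - l * t"
proof -
  define S where "S = insert 0 {(b - v) / (a - t) | a b. (a, b) \<in> C \<and> t < a}"
  have le_v: "b \<le> v" if "(a, b) \<in> C" "a \<le> t" for a b
    using mix[OF that(1) that(1), of 1] that by simp
  have bound: "s \<le> (v - b') / (t - a')" if "(a', b') \<in> C" "a' < t" "s \<in> S" for s a' b'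
    using that(3) unfolding S_def
  proof safe
    show "0 \<le> (v - b') / (t - a')" using le_v[OF that(1)] that(2) by simp
  next
    fix a b assume ab: "(a, b) \<in> C" "t < a"
    define \<alpha> where "\<alpha> = (t - a') / (a - a')"
    have \<alpha>: "0 \<le> \<alpha>" "\<alpha> \<le> 1" "1 - \<alpha> = (a - t) / (a - a')"
      using that(2) ab(2) by (auto simp: \<alpha>_def field_simps)
    have "\<alpha> * a + (1 - \<alpha>) * a' = ((t - a') * a + (a - t) * a') / (a - a')"
      unfolding \<alpha>(3) unfolding \<alpha>_def by (simp add: add_divide_distrib)
    also have "\<dots> = t" using that(2) ab(2) by (simp add: field_simps)
    finally have "\<alpha> * b + (1 - \<alpha>) * b' \<le> v" using mix[OF ab(1) that(1) \<alpha>(1,2)] by simp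
    then have "((t - a') * b + (a - t) * b') / (a - a') \<le> v"
      unfolding \<alpha>(3) unfolding \<alpha>_def by (simp add: add_divide_distrib)
    then have "(t - a') * b + (a - t) * b' \<le> v * (a - a')"
      using that(2) ab(2) by (simp add: pos_divide_le_eq)
    then have "(b - v) * (t - a') \<le> (v - b') * (a - t)" by (simp add: algebra_simps)
    then show "(b - v) / (a - t) \<le> (v - b') / (t - a')"
      using that(2) ab(2) by (simp add: field_simps)
  qed
  have bdd: "bdd_above S" using bound[OF base] by (auto simp: bdd_above_def)
  show thesis
  proof (rule that[of "Sup S"])
    show "0 \<le> Sup S" by (rule cSup_upper[OF _ bdd]) (simp add: S_def)
    fix a b assume ab: "(a, b) \<in> C"
    consider "a < t" | "a = t" | "t < a" by linarith
    then show "b - Sup S * a \<le> v - Sup S * t"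
    proof cases
      case 1
      have "Sup S \<le> (v - b) / (t - a)"
        using bound[OF ab 1] by (intro cSup_least) (auto simp: S_def)
      then show ?thesis using 1 by (simp add: field_simps)
    next
      case 2
      then show ?thesis using le_v[OF ab] by simp
    next
      case 3
      have "(b - v) / (a - t) \<le> Sup S"
        using ab 3 by (intro cSup_upper[OF _ bdd]) (auto simp: S_def)
      then show ?thesis using 3 by (simp add: field_simps)
    qed
  qed
qed


section \<open>Approximation of the gap by transport maps\<close>

text \<open>
  A sequence \<open>D\<close> whose graph points \<open>(D i, \<Psi> (D i))\<close> are dense in the graph of \<open>\<Psi>\<close>.  The net gain is
  continuous in \<open>(\<xi>, \<Psi> \<xi>)\<close>, so suprema over \<open>\<xi>\<close> may be taken over this sequence, for all \<open>l\<close> and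
  \<open>\<zeta>\<close> at once, even where \<open>\<Psi>\<close> is discontinuous.
\<close>

lemma countable_graph_dense:
  fixes \<Psi> :: "'a::polish_space \<Rightarrow> real"
  assumes "0 < p"
  obtains D :: "nat \<Rightarrow> 'a" where
    "\<And>l \<zeta> c \<xi>. (\<And>i. \<Psi> (D i) - l * dist (D i) \<zeta> powr p \<le> c) \<Longrightarrow> \<Psi> \<xi> - l * dist \<xi> \<zeta> powr p \<le> c"
proof -
  obtain \<B> :: "('a \<times> real) set set" where \<B>: "countable \<B>" "topological_basis \<B>"
    using ex_countable_basis by auto
  define pick where "pick U = (SOME \<xi>. (\<xi>, \<Psi> \<xi>) \<in> U)" for U
  have pick: "(pick U, \<Psi> (pick U)) \<in> U" if "(\<xi>, \<Psi> \<xi>) \<in> U" for U \<xi>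
    unfolding pick_def using that by (rule someI)
  have "\<B> \<noteq> {}" using topological_basisE[OF \<B>(2) open_UNIV] by blast
  show thesis
  proof (rule that[of "\<lambda>i. pick (from_nat_into \<B> i)"], rule ccontr)
    fix l \<zeta> c \<xi>
    assume le: "\<And>i. \<Psi> (pick (from_nat_into \<B> i)) - l * dist (pick (from_nat_into \<B> i)) \<zeta> powr p \<le> c"
      and "\<not> \<Psi> \<xi> - l * dist \<xi> \<zeta> powr p \<le> c"
    define W where "W = {z. c < snd z - l * dist (fst z) \<zeta> powr p}"
    have "open W"
      unfolding W_def using \<open>0 < p\<close>
      by (intro open_Collect_less continuous_intros continuous_on_powr') auto
    moreover have "(\<xi>, \<Psi> \<xi>) \<in> W"
      using \<open>\<not> \<Psi> \<xi> - l * dist \<xi> \<zeta> powr p \<le> c\<close> by (simp add: W_def)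
    ultimately obtain U where U: "U \<in> \<B>" "(\<xi>, \<Psi> \<xi>) \<in> U" "U \<subseteq> W"
      using topological_basisE[OF \<B>(2)] by blast
    obtain i where "U = from_nat_into \<B> i" using from_nat_into_surj[OF \<B>(1) U(1)] by auto
    then show False using le[of i] pick[OF U(2)] U(3) by (auto simp: W_def)
  qed
qed

text \<open>
  Greedy maximisation of \<open>g \<xi> \<zeta>\<close> over \<open>\<xi>\<close>: starting from the identity, step \<open>n = prod_encode (i, k)\<close>
  switches to the candidate \<open>D i\<close> where this is an improvement, but only within distance \<open>k\<close> of
  \<open>D 0\<close>.  The restriction to bounded sets keeps the moving cost integrable; the pairing offers each
  candidate on arbitrarily large balls.
\<close>

primrec best_response :: "('a::metric_space \<Rightarrow> 'a \<Rightarrow> real) \<Rightarrow> (nat \<Rightarrow> 'a) \<Rightarrow> nat \<Rightarrow> 'a \<Rightarrow> 'a" where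
  "best_response g D 0 = (\<lambda>\<zeta>. \<zeta>)"
| "best_response g D (Suc n) = (\<lambda>\<zeta>.
    if dist (D 0) \<zeta> \<le> real (snd (prod_decode n)) \<and>
       g (best_response g D n \<zeta>) \<zeta> < g (D (fst (prod_decode n))) \<zeta>
    then D (fst (prod_decode n)) else best_response g D n \<zeta>)"

text \<open>
  The greedy maps have integrable cost and gain, so their net gain over the identity has
  integral at most \<open>w - \<integral>\<Psi> d\<nu>\<close>.  These net gains increase pointwise to a limit no less than \<open>gap\<close>,
  and monotone convergence carries the bound over.
\<close>

lemma integral_gap_le:
  fixes \<nu> :: "'a::polish_space measure"
  assumes "1 \<le> p" "0 \<le> l" and \<nu>: "\<nu> \<in> space (prob_algebra borel)"
    and [measurable]: "\<Psi> \<in> borel_measurable borel" and int: "integrable \<nu> \<Psi>"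
    and le: "\<And>T. T \<in> borel \<rightarrow>\<^sub>M borel \<Longrightarrow> integrable \<nu> (\<lambda>\<zeta>. dist (T \<zeta>) \<zeta> powr p) \<Longrightarrow>
      integrable \<nu> (\<lambda>\<zeta>. \<Psi> (T \<zeta>)) \<Longrightarrow>
      (\<integral>\<zeta>. \<Psi> (T \<zeta>) \<partial>\<nu>) - l * (\<integral>\<zeta>. dist (T \<zeta>) \<zeta> powr p \<partial>\<nu>) \<le> w"
  shows "(\<integral>\<^sup>+ \<zeta>. gap p \<Psi> l \<zeta> \<partial>\<nu>) \<le> ennreal (w - (\<integral>\<zeta>. \<Psi> \<zeta> \<partial>\<nu>))"
proof -
  have sets_\<nu>[measurable_cong]: "sets \<nu> = sets borel" and "prob_space \<nu>"
    using \<nu> by (auto simp: space_prob_algebra)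
  interpret prob_space \<nu> by fact
  obtain D :: "nat \<Rightarrow> 'a" where D: "\<And>l \<zeta> c \<xi>. (\<And>i. \<Psi> (D i) - l * dist (D i) \<zeta> powr p \<le> c) \<Longrightarrow>
      \<Psi> \<xi> - l * dist \<xi> \<zeta> powr p \<le> c"
    using countable_graph_dense[of p \<Psi>] \<open>1 \<le> p\<close> by auto
  define g where "g \<xi> \<zeta> = \<Psi> \<xi> - l * dist \<xi> \<zeta> powr p" for \<xi> \<zeta>
  define T where "T = best_response g D"
  have T: "T n \<in> borel \<rightarrow>\<^sub>M borel \<and> integrable \<nu> (\<lambda>\<zeta>. dist (T n \<zeta>) \<zeta> powr p) \<and> integrable \<nu> (\<lambda>\<zeta>. \<Psi> (T n \<zeta>))" for n
  proof (induction n)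
    case 0
    show ?case using \<open>1 \<le> p\<close> int by (simp add: T_def)
  next
    case (Suc n)
    then have [measurable]: "T n \<in> borel \<rightarrow>\<^sub>M borel" by simp
    let ?\<xi> = "D (fst (prod_decode n))" and ?r = "real (snd (prod_decode n))"
    have T_Suc: "T (Suc n) = (\<lambda>\<zeta>. if dist (D 0) \<zeta> \<le> ?r \<and> g (T n \<zeta>) \<zeta> < g ?\<xi> \<zeta> then ?\<xi> else T n \<zeta>)"
      unfolding T_def best_response.simps ..
    have meas[measurable]: "T (Suc n) \<in> borel \<rightarrow>\<^sub>M borel"
      unfolding T_Suc g_def by measurable
    have bound_cost: "norm (dist (T (Suc n) \<zeta>) \<zeta> powr p) \<le> norm ((dist ?\<xi> (D 0) + ?r) powr p + dist (T n \<zeta>) \<zeta> powr p)" for \<zeta>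
    proof -
      have "dist ?\<xi> \<zeta> powr p \<le> (dist ?\<xi> (D 0) + ?r) powr p" if "dist (D 0) \<zeta> \<le> ?r"
        using that \<open>1 \<le> p\<close> dist_triangle[of ?\<xi> \<zeta> "D 0"] by (intro powr_mono2) auto
      then show ?thesis by (auto simp: T_Suc intro: add_increasing2)
    qed
    have cost: "integrable \<nu> (\<lambda>\<zeta>. dist (T (Suc n) \<zeta>) \<zeta> powr p)"
    proof (rule Bochner_Integration.integrable_bound[OF _ _ AE_I2[OF bound_cost]])
      show "integrable \<nu> (\<lambda>\<zeta>. (dist ?\<xi> (D 0) + ?r) powr p + dist (T n \<zeta>) \<zeta> powr p)"
        using Suc by (intro Bochner_Integration.integrable_add integrable_const) blast
    qed measurable
    have bound_gain: "norm (\<Psi> (T (Suc n) \<zeta>)) \<le> norm (\<bar>\<Psi> ?\<xi>\<bar> + \<bar>\<Psi> (T n \<zeta>)\<bar>)" for \<zeta>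
      by (simp add: T_Suc)
    have gain: "integrable \<nu> (\<lambda>\<zeta>. \<Psi> (T (Suc n) \<zeta>))"
    proof (rule Bochner_Integration.integrable_bound[OF _ _ AE_I2[OF bound_gain]])
      show "integrable \<nu> (\<lambda>\<zeta>. \<bar>\<Psi> ?\<xi>\<bar> + \<bar>\<Psi> (T n \<zeta>)\<bar>)"
        using Suc by (intro Bochner_Integration.integrable_add integrable_const integrable_abs) blast
    qed measurable
    show ?case using meas cost gain by blast
  qed
  then have [measurable]: "T n \<in> borel \<rightarrow>\<^sub>M borel" for n by simp
  define G where "G n \<zeta> = g (T n \<zeta>) \<zeta> - \<Psi> \<zeta>" for n \<zeta>
  have G_mono: "mono (\<lambda>n. G n \<zeta>)" for \<zeta>
    by (rule mono_iff_le_Suc[THEN iffD2]) (simp add: G_def T_def)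
  have "G 0 \<zeta> = 0" for \<zeta> using \<open>1 \<le> p\<close> by (simp add: G_def T_def g_def)
  then have G_nonneg: "0 \<le> G n \<zeta>" for n \<zeta> using monoD[OF G_mono, of 0 n \<zeta>] by simp
  have gap_le: "gap p \<Psi> l \<zeta> \<le> (SUP n. ennreal (G n \<zeta>))" for \<zeta>
  proof (cases "SUP n. ennreal (G n \<zeta>)")
    case (real s)
    have "gap p \<Psi> l \<zeta> \<le> ennreal s"
    proof (rule gap_leI, rule D)
      fix i
      obtain k :: nat where k: "dist (D 0) \<zeta> \<le> real k" using real_arch_simple by blast
      let ?n = "prod_encode (i, k)"
      have "g (D i) \<zeta> - \<Psi> \<zeta> \<le> G (Suc ?n) \<zeta>"
        using k by (simp add: G_def T_def)
      also have "\<dots> \<le> s"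
        using real SUP_upper[of "Suc ?n" UNIV "\<lambda>n. ennreal (G n \<zeta>)"] by simp
      finally show "\<Psi> (D i) - l * dist (D i) \<zeta> powr p \<le> \<Psi> \<zeta> + s" by (simp add: g_def)
    qed
    then show ?thesis using real by simp
  next
    case top
    then show ?thesis by (simp only: top_greatest)
  qed
  have "(\<integral>\<^sup>+ \<zeta>. gap p \<Psi> l \<zeta> \<partial>\<nu>) \<le> (\<integral>\<^sup>+ \<zeta>. (SUP n. ennreal (G n \<zeta>)) \<partial>\<nu>)"
    by (intro nn_integral_mono gap_le)
  also have "\<dots> = (SUP n. \<integral>\<^sup>+ \<zeta>. ennreal (G n \<zeta>) \<partial>\<nu>)"
  proof (rule nn_integral_monotone_convergence_SUP)
    show "incseq (\<lambda>n \<zeta>. ennreal (G n \<zeta>))"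
      using G_mono by (auto simp: incseq_def le_fun_def mono_def intro!: ennreal_leI)
    show "(\<lambda>\<zeta>. ennreal (G n \<zeta>)) \<in> borel_measurable \<nu>" for n
      unfolding G_def g_def by measurable
  qed
  also have "\<dots> \<le> ennreal (w - (\<integral>\<zeta>. \<Psi> \<zeta> \<partial>\<nu>))"
  proof (rule SUP_least)
    fix n
    have G_int: "integrable \<nu> (G n)"
      unfolding G_def g_def using T[of n] int by auto
    have "(\<integral>\<zeta>. G n \<zeta> \<partial>\<nu>) = (\<integral>\<zeta>. \<Psi> (T n \<zeta>) \<partial>\<nu>) - l * (\<integral>\<zeta>. dist (T n \<zeta>) \<zeta> powr p \<partial>\<nu>) - (\<integral>\<zeta>. \<Psi> \<zeta> \<partial>\<nu>)"
      unfolding G_def g_def using T[of n] int by simp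
    then have "(\<integral>\<zeta>. G n \<zeta> \<partial>\<nu>) \<le> w - (\<integral>\<zeta>. \<Psi> \<zeta> \<partial>\<nu>)"
      using le[of "T n"] T[of n] by simp
    then show "(\<integral>\<^sup>+ \<zeta>. ennreal (G n \<zeta>) \<partial>\<nu>) \<le> ennreal (w - (\<integral>\<zeta>. \<Psi> \<zeta> \<partial>\<nu>))"
      using nn_integral_eq_integral[OF G_int] G_nonneg by (simp add: ennreal_leI)
  qed
  finally show ?thesis .
qed

section \<open>Strong duality\<close>

lemma strong_duality:
  assumes p: "1 \<le> p" and \<theta>: "0 < \<theta>" and \<nu>: "\<nu> \<in> space (prob_algebra borel)"
    and \<Psi>: "\<Psi> \<in> borel_measurable borel" "integrable \<nu> \<Psi>"
  shows "dual_value p \<theta> \<nu> \<Psi> \<le> primal_value p \<theta> \<nu> \<Psi>"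
proof -
  let ?c = "\<lambda>T. \<integral>\<zeta>. dist (T \<zeta>) \<zeta> powr p \<partial>\<nu>" and ?b = "\<lambda>T. \<integral>\<zeta>. \<Psi> (T \<zeta>) \<partial>\<nu>"
  define \<T> where "\<T> = {T. T \<in> borel \<rightarrow>\<^sub>M borel \<and> integrable \<nu> (\<lambda>\<zeta>. dist (T \<zeta>) \<zeta> powr p) \<and>
      integrable \<nu> (\<lambda>\<zeta>. \<Psi> (T \<zeta>))}"
  define C where "C = (\<lambda>T. (?c T, ?b T)) ` \<T>"
  have mix: "ereal (\<alpha> * b + (1 - \<alpha>) * b') \<le> primal_value p \<theta> \<nu> \<Psi>"
    if C: "(a, b) \<in> C" "(a', b') \<in> C" and \<alpha>: "0 \<le> \<alpha>" "\<alpha> \<le> 1" "\<alpha> * a + (1 - \<alpha>) * a' \<le> \<theta> powr p"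
    for a b a' b' \<alpha>
  proof -
    obtain T T' where T: "T \<in> \<T>" "a = ?c T" "b = ?b T" "T' \<in> \<T>" "a' = ?c T'" "b' = ?b T'"
      using C unfolding C_def by auto
    show ?thesis
      using mixture_value_le_primal_value[OF p \<theta> \<nu> \<Psi>(1), of "\<lambda>c. if c then T else T'" \<alpha>] T \<alpha>
      by (simp add: \<T>_def)
  qed
  have "id \<in> \<T>" using \<Psi> p by (simp add: \<T>_def)
  then have base: "(0, \<integral>\<zeta>. \<Psi> \<zeta> \<partial>\<nu>) \<in> C"
    unfolding C_def using p by (intro image_eqI[of _ _ id]) auto
  have t: "0 < \<theta> powr p" using \<theta> by simp
  show ?thesis
  proof (cases "primal_value p \<theta> \<nu> \<Psi>")
    case (real v)
    \<comment> \<open>The identity costs \<open>0 < \<theta> powr p\<close>; this is where a positive radius is used.\<close>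
    obtain l where l: "0 \<le> l" "\<And>a b. (a, b) \<in> C \<Longrightarrow> b - l * a \<le> v - l * \<theta> powr p"
      using supporting_slope[OF base t, of v] mix unfolding real by auto
    have "(\<integral>\<^sup>+ \<zeta>. gap p \<Psi> l \<zeta> \<partial>\<nu>) \<le> ennreal (v - l * \<theta> powr p - (\<integral>\<zeta>. \<Psi> \<zeta> \<partial>\<nu>))"
      using l(2) by (intro integral_gap_le[OF p l(1) \<nu> \<Psi>]) (auto simp: C_def \<T>_def)
    moreover have "0 \<le> v - l * \<theta> powr p - (\<integral>\<zeta>. \<Psi> \<zeta> \<partial>\<nu>)" using l(2)[OF base] by simp
    ultimately have "enn2ereal (\<integral>\<^sup>+ \<zeta>. gap p \<Psi> l \<zeta> \<partial>\<nu>) \<le> ereal (v - l * \<theta> powr p - (\<integral>\<zeta>. \<Psi> \<zeta> \<partial>\<nu>))"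
      by (metis enn2ereal_ennreal less_eq_ennreal.rep_eq)
    then have "ereal (l * \<theta> powr p) - Phi_integral p \<nu> \<Psi> l \<le> ereal v"
      using p \<nu> \<Psi>(2) by (subst Phi_integral_eq)
        (auto simp: space_prob_algebra, cases "enn2ereal (\<integral>\<^sup>+ \<zeta>. gap p \<Psi> l \<zeta> \<partial>\<nu>)", auto)
    moreover have "dual_value p \<theta> \<nu> \<Psi> \<le> ereal (l * \<theta> powr p) - Phi_integral p \<nu> \<Psi> l"
      unfolding dual_value_def using l(1) by (intro INF_lower) simp
    ultimately show ?thesis using real by simp
  next
    case MInf
    then show ?thesis using mix[OF base base, of 0] t by simp
  qed simp
qed

theorem theorem1:
  fixes p \<theta> :: real
    and \<nu> :: "'a::polish_space measure"
    and \<Psi> :: "'a \<Rightarrow> real"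
  assumes "1 \<le> p"
    and "0 < \<theta>"
    and "\<nu> \<in> space (prob_algebra borel)"
    and "\<Psi> \<in> borel_measurable borel"
    and "integrable \<nu> \<Psi>"
    and "growth_rate p \<nu> \<Psi> < \<infinity>"
  shows "primal_value p \<theta> \<nu> \<Psi> = dual_value p \<theta> \<nu> \<Psi> \<and> dual_value p \<theta> \<nu> \<Psi> < \<infinity>"
proof
  have "sets \<nu> = sets borel" using assms(3) by (simp add: space_prob_algebra)
  then have "primal_value p \<theta> \<nu> \<Psi> \<le> dual_value p \<theta> \<nu> \<Psi>"
    unfolding dual_value_def using assms by (intro INF_greatest weak_duality) auto
  then show "primal_value p \<theta> \<nu> \<Psi> = dual_value p \<theta> \<nu> \<Psi>"
    using strong_duality assms by (intro antisym)
  obtain l where l: "0 \<le> l" "Phi_integral p \<nu> \<Psi> l > - \<infinity>"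
    using assms(6) unfolding growth_rate_def Inf_less_iff by blast
  have "dual_value p \<theta> \<nu> \<Psi> \<le> ereal (l * \<theta> powr p) - Phi_integral p \<nu> \<Psi> l"
    unfolding dual_value_def using l(1) by (intro INF_lower) simp
  also have "\<dots> < \<infinity>" using l(2) by (cases "Phi_integral p \<nu> \<Psi> l") auto
  finally show "dual_value p \<theta> \<nu> \<Psi> < \<infinity>" .
qed

end
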